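(* Let $G$ be a finite graph. If there exists a spanning tree $T$ in $G$ such that $T\to G$, then $X^{(2)}(G)$ is simply connected.
   Context: For a graph $G$ and a spanning subgraph $H\subseteq G$ (i.e. $V(H)=V(G)$), we say that $H$ activates $G$, and write $H\to G$, if there is a sequence of graphs $H=H_0\subset H_1\subset\cdots\subset H_s=G$ such that for every $i\in\{1,\dots,s\}$ the graph $H_i$ is obtained from $H_{i-1}$ by adding one edge that belongs to a triangle of $H_i$. $X^{(2)}(G)$ is the simplicial complex whose faces are the vertices, edges and triangles of $G$. Simply connected means connected with trivial fundamental group (equivalently, the 1-skeleton is connected and every cycle in the 1-skeleton is contractible in the complex). *)

theory Defs
  imports "HOL-Analysis.Analysis"
begin

record 'a sgraph =
  verts :: "'a set"
  edges :: "'a set set"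

definition finite_simple_graph :: "'a sgraph \<Rightarrow> bool" where
  "finite_simple_graph G \<longleftrightarrow> finite (verts G) \<and> (\<forall>e\<in>edges G. e \<subseteq> verts G \<and> card e = 2)"

definition spanning_subgraph :: "'a sgraph \<Rightarrow> 'a sgraph \<Rightarrow> bool" where
  "spanning_subgraph H G \<longleftrightarrow> verts H = verts G \<and> edges H \<subseteq> edges G"

definition walk :: "'a sgraph \<Rightarrow> 'a list \<Rightarrow> bool" where
  "walk G p \<longleftrightarrow> p \<noteq> [] \<and> set p \<subseteq> verts G \<and> successively (\<lambda>u v. {u, v} \<in> edges G) p"

(* The empty graph is not counted as connected. *)
definition connected_graph :: "'a sgraph \<Rightarrow> bool" where
  "connected_graph G \<longleftrightarrow> verts G \<noteq> {} \<and>
     (\<forall>u\<in>verts G. \<forall>v\<in>verts G. \<exists>p. walk G p \<and> hd p = u \<and> last p = v)"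

(* A cycle is given by its list of pairwise distinct vertices; the first one is not repeated at
   the end. *)
definition cycle :: "'a sgraph \<Rightarrow> 'a list \<Rightarrow> bool" where
  "cycle G c \<longleftrightarrow> 3 \<le> length c \<and> distinct c \<and> walk G c \<and> {last c, hd c} \<in> edges G"

definition tree :: "'a sgraph \<Rightarrow> bool" where
  "tree G \<longleftrightarrow> connected_graph G \<and> (\<nexists>c. cycle G c)"

definition spanning_tree :: "'a sgraph \<Rightarrow> 'a sgraph \<Rightarrow> bool" where
  "spanning_tree T G \<longleftrightarrow> spanning_subgraph T G \<and> tree T"

(* A triangle is identified with its vertex set; in a simple graph the three vertices below are
   automatically distinct. *)
definition triangles :: "'a sgraph \<Rightarrow> 'a set set" where
  "triangles G = {{u, v, w} | u v w. {u, v} \<in> edges G \<and> {v, w} \<in> edges G \<and> {u, w} \<in> edges G}"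

definition activation_step :: "'a sgraph \<Rightarrow> 'a sgraph \<Rightarrow> bool" where
  "activation_step H H' \<longleftrightarrow> verts H' = verts H \<and>
     (\<exists>e. e \<notin> edges H \<and> edges H' = insert e (edges H) \<and> (\<exists>t\<in>triangles H'. e \<subseteq> t))"

definition activates :: "'a sgraph \<Rightarrow> 'a sgraph \<Rightarrow> bool" where
  "activates H G \<longleftrightarrow> spanning_subgraph H G \<and>
     (\<exists>(s::nat) K. K 0 = H \<and> K s = G \<and> (\<forall>i\<in>{1..s}. activation_step (K (i - 1)) (K i)))"

definition triangle_complex :: "'a sgraph \<Rightarrow> 'a set set" where
  "triangle_complex G = {{v} | v. v \<in> verts G} \<union> edges G \<union> triangles G"

(* The vertex v is placed at the standard basis vector axis v 1, so the vertices are affinely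
   independent and two simplices meet exactly in the simplex on their common vertices. *)
definition geometric_realization :: "'a::finite set set \<Rightarrow> (real ^ 'a) set" where
  "geometric_realization K = (\<Union>F\<in>K. convex hull ((\<lambda>v. axis v 1) ` F))"

end

theory Submission
  imports Defs
begin

text \<open>
  Let \<open>X\<close> be the realization of the complex of \<open>G\<close> and \<open>r\<close> a vertex. The idea is to choose for
  every point \<open>x\<close> of \<open>X\<close> one path \<open>h x\<close> from \<open>r\<close> to \<open>x\<close> in such a way that every path \<open>p\<close> in \<open>X\<close>,
  say from \<open>x\<close> to \<open>y\<close>, carries \<open>h x\<close> to \<open>h y\<close>: following \<open>h x\<close> and then \<open>p\<close> is homotopic to
  \<open>h y\<close>. A loop \<open>p\<close> at \<open>x\<close> then satisfies \<open>h x +++ p \<simeq> h x\<close>, and cancelling \<open>h x\<close> shows that \<open>p\<close> is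
  null-homotopic. In other words, \<open>h\<close> is a section of the universal cover.

  At the vertices such a choice is dictated by the spanning tree: \<open>g v\<close> runs from \<open>r\<close> to \<open>v\<close> inside
  the tree. The edges of the tree carry these paths to one another because a tree can be grown from
  its root one edge at a time, each edge defining the base path of the vertex it reaches
  (\<open>tree_base_paths\<close>). An activated edge \<open>uv\<close> closes a triangle \<open>uwv\<close> whose other two edges are
  already known to carry base paths, and in that triangle \<open>uv\<close> is homotopic to \<open>uw\<close> followed by
  \<open>wv\<close>. Thus the property spreads along the activation sequence to all edges of \<open>G\<close>
  (\<open>activation_carries\<close>).

  From the vertices one passes to arbitrary points by going straight from a vertex of the carrier
  simplex to the point. Every point has a neighbourhood inside the open star of some vertex, and open
  stars are starlike, so each short path can be replaced by a detour through that vertex; this gives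
  the property for short paths (\<open>simply_connected_realization\<close>). The property is stable under
  concatenation, so compactness of the unit interval yields it for all paths
  (\<open>simply_connected_if_carries\<close>).
\<close>

section \<open>Transport of base paths\<close>

text \<open>
  If \<open>S\<close> has a universal cover, viewed as the space of homotopy classes of paths from the common
  starting point of \<open>g\<close> and \<open>h\<close>, then \<open>carries S g p h\<close> says that the lift of \<open>p\<close> starting at the point
  represented by \<open>g\<close> ends at the point represented by \<open>h\<close>. The condition on endpoints is stated
  separately because \<open>g +++ p\<close> is a concatenation only when they match.
\<close>

definition carries :: "'b::real_normed_vector set \<Rightarrow> (real \<Rightarrow> 'b) \<Rightarrow> (real \<Rightarrow> 'b) \<Rightarrow> (real \<Rightarrow> 'b) \<Rightarrow> bool"
  where "carries S g p h \<longleftrightarrow> pathfinish g = pathstart p \<and> homotopic_paths S (g +++ p) h"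

lemma carriesD:
  assumes "carries S g p h"
  shows "path g" "path p" "path h" "path_image g \<subseteq> S" "path_image p \<subseteq> S" "path_image h \<subseteq> S"
    "pathfinish g = pathstart p" "pathstart h = pathstart g" "pathfinish h = pathfinish p"
    "homotopic_paths S (g +++ p) h"
proof -
  have e: "pathfinish g = pathstart p" and h: "homotopic_paths S (g +++ p) h"
    using assms by (auto simp: carries_def)
  show "pathfinish g = pathstart p" "homotopic_paths S (g +++ p) h" by fact+
  show "path g" "path p" "path h"
    using homotopic_paths_imp_path[OF h] e by auto
  show "path_image g \<subseteq> S" "path_image p \<subseteq> S" "path_image h \<subseteq> S"
    using homotopic_paths_imp_subset[OF h] e by (auto simp: path_image_join)
  show "pathstart h = pathstart g" "pathfinish h = pathfinish p"
    using homotopic_paths_imp_pathstart[OF h] homotopic_paths_imp_pathfinish[OF h] by auto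
qed

lemma carries_join_self:
  assumes "path g" "path_image g \<subseteq> S" "path p" "path_image p \<subseteq> S" "pathfinish g = pathstart p"
  shows "carries S g p (g +++ p)"
  using assms by (simp add: carries_def subset_path_image_join)

lemma carries_const:
  assumes "path g" "path_image g \<subseteq> S" "pathfinish g = a"
  shows "carries S g (linepath a a) g"
  using assms by (auto simp: carries_def intro: homotopic_paths_rid')

lemma carries_homotopic:
  assumes "carries S g p h" "homotopic_paths S p q"
  shows "carries S g q h"
proof -
  note c = carriesD[OF assms(1)]
  have "homotopic_paths S (g +++ q) (g +++ p)"
    using c by (intro homotopic_paths_join homotopic_paths_sym[OF assms(2)])
      (auto simp: homotopic_paths_imp_pathstart[OF assms(2)])
  then show ?thesis
    using c homotopic_paths_imp_pathstart[OF assms(2)]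
    by (auto simp: carries_def intro: homotopic_paths_trans)
qed

lemma carries_trans:
  assumes "carries S g p h" "carries S h q k"
  shows "carries S g (p +++ q) k"
proof -
  note c = carriesD[OF assms(1)] and d = carriesD[OF assms(2)]
  have pq: "pathfinish p = pathstart q" using c d by simp
  have "homotopic_paths S (g +++ (p +++ q)) ((g +++ p) +++ q)"
    using c d pq by (intro homotopic_paths_assoc) auto
  also have "homotopic_paths S ((g +++ p) +++ q) (h +++ q)"
    using c d pq by (intro homotopic_paths_join) auto
  also have "homotopic_paths S (h +++ q) k" by (rule d(10))
  finally show ?thesis using c by (simp add: carries_def)
qed

lemma carries_reverse:
  assumes "carries S g p h"
  shows "carries S h (reversepath p) g"
proof -
  note c = carriesD[OF assms]
  have "homotopic_paths S (h +++ reversepath p) ((g +++ p) +++ reversepath p)"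
    using c by (intro homotopic_paths_join homotopic_paths_sym[OF c(10)]) auto
  also have "homotopic_paths S ((g +++ p) +++ reversepath p) (g +++ (p +++ reversepath p))"
    using c by (intro homotopic_paths_sym[OF homotopic_paths_assoc]) auto
  also have "homotopic_paths S (g +++ (p +++ reversepath p)) (g +++ linepath (pathstart p) (pathstart p))"
    using c by (intro homotopic_paths_join homotopic_paths_rinv) auto
  also have "homotopic_paths S (g +++ linepath (pathstart p) (pathstart p)) g"
    using c by (intro homotopic_paths_rid') auto
  finally show ?thesis using c by (simp add: carries_def)
qed

lemma carries_self_imp_null_homotopic:
  assumes "carries S g p g"
  shows "homotopic_paths S p (linepath (pathstart p) (pathstart p))"
proof -
  note c = carriesD[OF assms]
  let ?o = "linepath (pathstart p) (pathstart p)"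
  have "homotopic_paths S p (?o +++ p)"
    using c by (intro homotopic_paths_sym[OF homotopic_paths_lid]) auto
  also have "homotopic_paths S (?o +++ p) ((reversepath g +++ g) +++ p)"
    using c homotopic_paths_linv[of g S]
    by (intro homotopic_paths_join) (auto intro: homotopic_paths_sym)
  also have "homotopic_paths S ((reversepath g +++ g) +++ p) (reversepath g +++ (g +++ p))"
    using c by (intro homotopic_paths_sym[OF homotopic_paths_assoc]) auto
  also have "homotopic_paths S (reversepath g +++ (g +++ p)) (reversepath g +++ g)"
    using c by (intro homotopic_paths_join) auto
  also have "homotopic_paths S (reversepath g +++ g) ?o"
    using c homotopic_paths_linv[of g S] by simp
  finally show ?thesis .
qed

lemma carries_within_simply_connected:
  assumes "carries S g p h" "path q" "pathstart q = pathstart p" "pathfinish q = pathfinish p"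
    and "simply_connected D" "D \<subseteq> S" "path_image p \<subseteq> D" "path_image q \<subseteq> D"
  shows "carries S g q h"
proof -
  have "homotopic_paths D p q"
    using assms carriesD(2)[OF assms(1)] unfolding simply_connected_eq_homotopic_paths by simp
  then show ?thesis
    using assms(1,6) carries_homotopic homotopic_paths_subset by blast
qed

text \<open>
  The local hypothesis alone makes \<open>h\<close> a consistent family of base paths: consistency along a path
  passes to concatenations, so it can be bisected down to subpaths short enough to lie in one of the
  given balls.
\<close>

lemma simply_connected_if_carries:
  fixes S :: "'b::real_normed_vector set"
  assumes base: "\<And>x. x \<in> S \<Longrightarrow> path (h x) \<and> path_image (h x) \<subseteq> S \<and> pathstart (h x) = r \<and> pathfinish (h x) = x"
    and local: "\<And>x. x \<in> S \<Longrightarrow> \<exists>e>0. \<forall>p. path p \<and> path_image p \<subseteq> S \<inter> ball x e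
                  \<longrightarrow> carries S (h (pathstart p)) p (h (pathfinish p))"
  shows "simply_connected S"
proof -
  have global: "carries S (h (pathstart p)) p (h (pathfinish p))"
    if p: "path p" and pS: "path_image p \<subseteq> S" for p
  proof -
    define P where "P s t \<longleftrightarrow> (0 \<le> s \<and> s \<le> t \<and> t \<le> 1 \<longrightarrow> carries S (h (p s)) (subpath s t p) (h (p t)))" for s t
    have "P 0 1"
    proof (rule Bolzano[OF zero_le_one])
      fix a b c assume trans: "P a b" "P b c" "a \<le> b" "b \<le> c"
      show "P a c" unfolding P_def
      proof
        assume ac: "0 \<le> a \<and> a \<le> c \<and> c \<le> 1"
        have "carries S (h (p a)) (subpath a b p +++ subpath b c p) (h (p c))"
          using trans ac unfolding P_def by (intro carries_trans[where h = "h (p b)"]) auto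
        moreover have "homotopic_paths S (subpath a b p +++ subpath b c p) (subpath a c p)"
          using trans ac p pS by (intro homotopic_join_subpaths) auto
        ultimately show "carries S (h (p a)) (subpath a c p) (h (p c))"
          by (rule carries_homotopic)
      qed
    next
      fix t :: real assume local: "0 \<le> t" "t \<le> 1"
      then have "p t \<in> S" using pS by (auto simp: path_image_def)
      from assms(2)[OF this] obtain e where e: "e > 0"
        and c: "\<And>q. path q \<Longrightarrow> path_image q \<subseteq> S \<inter> ball (p t) e \<Longrightarrow> carries S (h (pathstart q)) q (h (pathfinish q))"
        by blast
      have "continuous_on {0..1} p" using p by (simp add: path_def)
      then obtain d where d: "d > 0" "\<And>u. u \<in> {0..1} \<Longrightarrow> dist u t < d \<Longrightarrow> dist (p u) (p t) < e"
        using local e unfolding continuous_on_iff by (metis atLeastAtMost_iff)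
      show "\<exists>d>0. \<forall>a b. a \<le> t \<and> t \<le> b \<and> b - a < d \<longrightarrow> P a b"
      proof (intro exI[of _ d] conjI allI impI)
        fix a b assume ab: "a \<le> t \<and> t \<le> b \<and> b - a < d"
        show "P a b" unfolding P_def
        proof
          assume *: "0 \<le> a \<and> a \<le> b \<and> b \<le> 1"
          have "path_image (subpath a b p) \<subseteq> S \<inter> ball (p t) e"
          proof
            fix x assume "x \<in> path_image (subpath a b p)"
            then obtain u where u: "u \<in> {a..b}" "x = p u"
              using * by (auto simp: path_image_subpath)
            have "dist (p u) (p t) < e" using u ab * by (intro d) (auto simp: dist_real_def)
            moreover have "x \<in> S" using u * pS by (auto simp: path_image_def)
            ultimately show "x \<in> S \<inter> ball (p t) e" using u by (simp add: dist_commute)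
          qed
          then show "carries S (h (p a)) (subpath a b p) (h (p b))"
            using c[of "subpath a b p"] * p by simp
        qed
      qed (rule d)
    qed
    then show ?thesis by (simp add: P_def pathstart_def pathfinish_def)
  qed
  have "path_connected S"
  proof (unfold path_connected_def, intro ballI)
    fix x y assume "x \<in> S" "y \<in> S"
    then show "\<exists>p. path p \<and> path_image p \<subseteq> S \<and> pathstart p = x \<and> pathfinish p = y"
      using base[of x] base[of y]
      by (intro exI[of _ "reversepath (h x) +++ h y"]) (simp add: subset_path_image_join)
  qed
  then show ?thesis
    unfolding simply_connected_eq_contractible_path
    using global carries_self_imp_null_homotopic by metis
qed

section \<open>Growing a tree from its root\<close>

text \<open>
  A chain that returns to a vertex it has already visited is cut back to the first visit.
\<close>

lemma rtrancl_imp_distinct_chain: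
  assumes "(u, v) \<in> R\<^sup>*"
  shows "\<exists>p. p \<noteq> [] \<and> distinct p \<and> successively (\<lambda>x y. (x, y) \<in> R) p \<and> hd p = u \<and> last p = v"
  using assms
proof (induction rule: rtrancl_induct)
  case base
  show ?case by (intro exI[of _ "[u]"]) auto
next
  case (step y z)
  then obtain p where p: "p \<noteq> []" "distinct p" "successively (\<lambda>x y. (x, y) \<in> R) p" "hd p = u" "last p = y"
    by blast
  show ?case
  proof (cases "z \<in> set p")
    case True
    then obtain xs ys where "p = xs @ z # ys" by (meson split_list)
    moreover from this have "hd (xs @ [z]) = u" using p by (cases xs) auto
    ultimately show ?thesis using p
      by (intro exI[of _ "xs @ [z]"]) (auto simp: successively_append_iff)
  next
    case False
    then show ?thesis using p step
      by (intro exI[of _ "p @ [z]"]) (auto simp: successively_append_iff)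
  qed
qed

lemma walk_leaves_set:
  assumes "walk G p" "hd p \<in> U" "last p \<notin> U"
  shows "\<exists>u w. {u, w} \<in> edges G \<and> u \<in> U \<and> w \<in> verts G \<and> w \<notin> U"
  using assms
proof (induction p)
  case (Cons x p)
  show ?case
  proof (cases "p = []")
    case True then show ?thesis using Cons.prems by simp
  next
    case False
    then have "walk G p" "{x, hd p} \<in> edges G" "hd p \<in> verts G"
      using Cons.prems(1) by (auto simp: walk_def successively_Cons)
    then show ?thesis
      using Cons False by (cases "hd p \<in> U") auto
  qed
qed (simp add: walk_def)

text \<open>
  If the edge were missing from \<open>E\<close>, a chain of edges in \<open>E\<close> without repetitions between its ends
  would have at least three vertices, and the edge would close it to a cycle.
\<close>

lemma acyclic_edge_in_connecting_subset:
  assumes acyclic: "\<nexists>c. cycle G c" and simple: "\<forall>e\<in>edges G. e \<subseteq> verts G \<and> card e = 2"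
    and E: "E \<subseteq> edges G" and conn: "(u, v) \<in> {(x, y). {x, y} \<in> E}\<^sup>*" and uv: "{u, v} \<in> edges G"
  shows "{u, v} \<in> E"
proof (rule ccontr)
  assume notE: "{u, v} \<notin> E"
  have ne: "u \<noteq> v" using simple uv by fastforce
  obtain p where p: "p \<noteq> []" "distinct p" "successively (\<lambda>x y. {x, y} \<in> E) p" "hd p = u" "last p = v"
    using rtrancl_imp_distinct_chain[OF conn] by auto
  have "3 \<le> length p"
  proof (rule ccontr)
    assume "\<not> 3 \<le> length p"
    then consider x where "p = [x]" | x y where "p = [x, y]"
      using p(1) by (cases p rule: remdups_adj.cases) (auto simp: not_le less_Suc_eq numeral_3_eq_3)
    then show False using p notE ne by cases auto
  qed
  moreover have "set p \<subseteq> verts G" if "successively (\<lambda>x y. {x, y} \<in> E) p" "2 \<le> length p" for p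
    using that
  proof (induction p rule: induct_list012)
    case (3 x y zs)
    then have "{x, y} \<in> edges G" using E by auto
    then have "{x, y} \<subseteq> verts G" using simple by blast
    with 3 show ?case by (cases "zs = []") (auto simp: Suc_le_eq)
  qed auto
  moreover have "successively (\<lambda>x y. {x, y} \<in> edges G) p"
    using p(3) by (rule successively_mono) (use E in auto)
  ultimately have "cycle G p"
    using p uv by (simp add: cycle_def walk_def insert_commute)
  with acyclic show False by blast
qed

text \<open>
  A tree can be grown from any root by attaching one new vertex with one edge at a time. Take a
  maximal vertex set reached in this way: connectedness shows that it contains all vertices, and then
  acyclicity shows that the edges used are all the edges. The hypothesis \<open>E \<subseteq> Pow U\<close> in the growing step
  ensures that data chosen for the new vertex do not disturb what is known about the old edges.
\<close>

lemma tree_induct [consumes 4, case_names root grow]: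
  assumes tree: "tree T" and fin: "finite (verts T)"
    and simple: "\<forall>e\<in>edges T. e \<subseteq> verts T \<and> card e = 2" and r: "r \<in> verts T"
    and root: "P {r} {}"
    and grow: "\<And>U E u w. \<lbrakk>P U E; E \<subseteq> Pow U; u \<in> U; w \<notin> U; {u, w} \<in> edges T\<rbrakk>
                 \<Longrightarrow> P (insert w U) (insert {u, w} E)"
  shows "P (verts T) (edges T)"
proof -
  define R where "R E = {(x, y). {x, y} \<in> E}" for E :: "'a set set"
  have symR: "sym ((R E)\<^sup>*)" for E
    by (rule sym_rtrancl) (auto simp: R_def sym_def insert_commute)
  define A where "A = {U. U \<subseteq> verts T \<and> r \<in> U \<and>
      (\<exists>E \<subseteq> edges T \<inter> Pow U. P U E \<and> (\<forall>x\<in>U. (r, x) \<in> (R E)\<^sup>*))}"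
  have "finite A" using fin by (auto simp: A_def intro: finite_subset[OF _ finite_Pow_iff[THEN iffD2]])
  moreover have "{r} \<in> A" using r root by (auto simp: A_def)
  ultimately obtain U where U: "U \<in> A" and max: "\<And>U'. U' \<in> A \<Longrightarrow> U \<subseteq> U' \<Longrightarrow> U' = U"
    using finite_has_maximal2[of A "{r}"] by metis
  from U obtain E where UV: "U \<subseteq> verts T" "r \<in> U" and E: "E \<subseteq> edges T" "E \<subseteq> Pow U" "P U E"
    and conn: "\<And>x. x \<in> U \<Longrightarrow> (r, x) \<in> (R E)\<^sup>*"
    by (auto simp: A_def)
  have "U = verts T"
  proof (rule ccontr)
    assume "U \<noteq> verts T"
    then obtain v where v: "v \<in> verts T" "v \<notin> U" using UV by blast
    then obtain p where "walk T p" "hd p = r" "last p = v"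
      using tree r unfolding tree_def connected_graph_def by blast
    then obtain u w where uw: "{u, w} \<in> edges T" "u \<in> U" "w \<in> verts T" "w \<notin> U"
      using walk_leaves_set UV v by metis
    let ?E = "insert {u, w} E"
    have mono: "(R E)\<^sup>* \<subseteq> (R ?E)\<^sup>*" by (rule rtrancl_mono) (auto simp: R_def)
    have "(u, w) \<in> R ?E" by (simp add: R_def)
    then have "(r, w) \<in> (R ?E)\<^sup>*" using mono conn[OF uw(2)] by (meson rtrancl.rtrancl_into_rtrancl subsetD)
    then have "insert w U \<in> A"
      using uw UV E grow[OF E(3,2) uw(2,4,1)] mono conn unfolding A_def
      by (intro CollectI conjI exI[of _ ?E]) auto
    with max uw(4) show False by blast
  qed
  moreover have "E = edges T"
  proof
    show "edges T \<subseteq> E"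
    proof
      fix e assume e: "e \<in> edges T"
      then obtain u v where uv: "e = {u, v}" using simple card_2_iff[of e] by auto
      then have "(r, u) \<in> (R E)\<^sup>*" "(r, v) \<in> (R E)\<^sup>*"
        using conn simple e \<open>U = verts T\<close> by auto
      then have "(u, r) \<in> (R E)\<^sup>*" "(r, v) \<in> (R E)\<^sup>*"
        using symR[of E] by (auto dest: symD)
      then have "(u, v) \<in> (R E)\<^sup>*" by simp
      then show "e \<in> E"
        using acyclic_edge_in_connecting_subset[OF _ simple E(1)] tree e uv
        by (auto simp: tree_def R_def)
    qed
  qed (rule E)
  ultimately show ?thesis using E by simp
qed

text \<open>
  The base path of a new vertex is that of its neighbour in the tree, prolonged by the joining edge.
  Here \<open>f\<close> places the vertices in \<open>S\<close>.
\<close>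

lemma tree_base_paths:
  fixes f :: "'a \<Rightarrow> 'b::real_normed_vector"
  assumes tree: "tree T" and fin: "finite (verts T)"
    and simple: "\<forall>e\<in>edges T. e \<subseteq> verts T \<and> card e = 2" and r: "r \<in> verts T"
    and fr: "f r \<in> S" and seg: "\<And>u v. {u, v} \<in> edges T \<Longrightarrow> closed_segment (f u) (f v) \<subseteq> S"
  shows "\<exists>g. (\<forall>v\<in>verts T. path (g v) \<and> path_image (g v) \<subseteq> S \<and> pathstart (g v) = f r \<and> pathfinish (g v) = f v)
           \<and> (\<forall>u v. {u, v} \<in> edges T \<longrightarrow> carries S (g u) (linepath (f u) (f v)) (g v))"
  using tree fin simple r
proof (induction rule: tree_induct)
  case root
  show ?case using fr by (intro exI[of _ "\<lambda>_. linepath (f r) (f r)"]) (simp add: path_def pathstart_def pathfinish_def)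
next
  case (grow U E u w)
  then obtain g where
    g: "\<And>v. v \<in> U \<Longrightarrow> path (g v) \<and> path_image (g v) \<subseteq> S \<and> pathstart (g v) = f r \<and> pathfinish (g v) = f v"
    and c: "\<And>u v. {u, v} \<in> E \<Longrightarrow> carries S (g u) (linepath (f u) (f v)) (g v)"
    by blast
  define g' where "g' = g(w := g u +++ linepath (f u) (f w))"
  have uw: "carries S (g' u) (linepath (f u) (f w)) (g' w)"
    using g[OF grow(3)] seg[OF grow(5)] grow(3,4) unfolding g'_def
    by (auto intro!: carries_join_self)
  then have wu: "carries S (g' w) (linepath (f w) (f u)) (g' u)"
    using carries_reverse by fastforce
  have old: "g' v = g v" if "v \<in> U" for v using that grow(4) by (auto simp: g'_def)
  show ?case
  proof (intro exI[of _ g'] conjI ballI allI impI)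
    fix v assume "v \<in> insert w U"
    then show "path (g' v)" "path_image (g' v) \<subseteq> S" "pathstart (g' v) = f r" "pathfinish (g' v) = f v"
      using g[of v] g[OF grow(3)] old[of v] old[OF grow(3)] carriesD[OF uw] by auto
  next
    fix x y assume "{x, y} \<in> insert {u, w} E"
    then consider "x = u" "y = w" | "x = w" "y = u" | "{x, y} \<in> E" by (auto simp: doubleton_eq_iff)
    then show "carries S (g' x) (linepath (f x) (f y)) (g' y)"
    proof cases
      case 3
      then have "x \<in> U" "y \<in> U" using grow(2) by auto
      then show ?thesis using c[OF 3] old by simp
    qed (use uw wu in auto)
  qed
qed

section \<open>Activation\<close>

text \<open>
  Only one edge is new, and the other two edges of the triangle contain its third vertex.
\<close>

lemma activation_step_triangle:
  assumes "activation_step H H'" and simple: "\<And>e. e \<in> edges H' \<Longrightarrow> card e = 2"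
    and uv: "{u, v} \<in> edges H'" "{u, v} \<notin> edges H"
  shows "\<exists>w. {u, w} \<in> edges H \<and> {w, v} \<in> edges H \<and> {u, w, v} \<in> triangles H'"
proof -
  from assms(1) obtain e t where e: "edges H' = insert e (edges H)" and t: "t \<in> triangles H'" "e \<subseteq> t"
    by (auto simp: activation_step_def)
  have [simp]: "e = {u, v}" using uv e by auto
  from t obtain a b c where abc: "t = {a, b, c}" "{a, b} \<in> edges H'" "{b, c} \<in> edges H'" "{a, c} \<in> edges H'"
    by (auto simp: triangles_def)
  have ne: "a \<noteq> b" "b \<noteq> c" "a \<noteq> c" "u \<noteq> v"
    using simple[OF abc(2)] simple[OF abc(3)] simple[OF abc(4)] simple[OF uv(1)] by auto
  have "\<exists>w. t = {u, w, v} \<and> {u, w} \<in> edges H' \<and> {w, v} \<in> edges H' \<and> w \<noteq> u \<and> w \<noteq> v"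
    using t(2) abc ne by (auto simp: insert_commute)
  then show ?thesis using e t(1) by (auto simp: doubleton_eq_iff)
qed

text \<open>
  Along the activation sequence, each new edge is homotopic, within a filled triangle of \<open>G\<close>, to the
  path formed by the two old edges of that triangle.
\<close>

lemma activation_carries:
  assumes act: "activates H G" and simple: "\<And>e. e \<in> edges G \<Longrightarrow> card e = 2"
    and tri: "\<And>u v w. {u, v, w} \<in> triangles G \<Longrightarrow> convex hull {f u, f v, f w} \<subseteq> S"
    and c: "\<And>u v. {u, v} \<in> edges H \<Longrightarrow> carries S (g u) (linepath (f u) (f v)) (g v)"
    and uv: "{u, v} \<in> edges G"
  shows "carries S (g u) (linepath (f u) (f v)) (g v)"
proof -
  obtain s K where K: "K 0 = H" "K s = G" and step: "\<And>i. i < s \<Longrightarrow> activation_step (K i) (K (Suc i))"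
    using act unfolding activates_def
    by (metis atLeastAtMost_iff diff_Suc_1 less_eq_Suc_le One_nat_def Suc_le_mono le0)
  have sub: "edges (K i) \<subseteq> edges G" if "i \<le> s" for i
    using that
  proof (induction rule: inc_induct)
    case (step i)
    then show ?case using \<open>\<And>i. i < s \<Longrightarrow> activation_step (K i) (K (Suc i))\<close>[of i]
      by (auto simp: activation_step_def)
  qed (simp add: K)
  have "\<forall>u v. {u, v} \<in> edges (K i) \<longrightarrow> carries S (g u) (linepath (f u) (f v)) (g v)" if "i \<le> s" for i
    using that
  proof (induction i)
    case 0
    then show ?case using c K by simp
  next
    case (Suc i)
    have IH: "carries S (g u) (linepath (f u) (f v)) (g v)" if "{u, v} \<in> edges (K i)" for u v
      using Suc that by simp
    show ?case
    proof (intro allI impI)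
      fix u v assume uv: "{u, v} \<in> edges (K (Suc i))"
      show "carries S (g u) (linepath (f u) (f v)) (g v)"
      proof (cases "{u, v} \<in> edges (K i)")
        case False
        have "activation_step (K i) (K (Suc i))" using step Suc.prems by simp
        then obtain w where w: "{u, w} \<in> edges (K i)" "{w, v} \<in> edges (K i)" "{u, w, v} \<in> triangles (K (Suc i))"
          using activation_step_triangle[OF _ _ uv False] simple sub[OF Suc.prems] by blast
        have "{u, w, v} \<in> triangles G"
          using w(3) sub[OF Suc.prems] unfolding triangles_def by blast
        then have D: "convex hull {f u, f w, f v} \<subseteq> S" by (rule tri)
        have chain: "carries S (g u) (linepath (f u) (f w) +++ linepath (f w) (f v)) (g v)"
          using IH w carries_trans by blast
        have seg: "closed_segment a b \<subseteq> convex hull {f u, f w, f v}"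
          if "a \<in> {f u, f w, f v}" "b \<in> {f u, f w, f v}" for a b
          using that by (intro closed_segment_subset) (auto intro: hull_inc)
        show ?thesis
        proof (rule carries_within_simply_connected[OF chain _ _ _ _ D])
          show "simply_connected (convex hull {f u, f w, f v})"
            by (simp add: convex_imp_simply_connected)
          show "path_image (linepath (f u) (f w) +++ linepath (f w) (f v)) \<subseteq> convex hull {f u, f w, f v}"
            by (intro subset_path_image_join) (simp_all add: seg)
          show "path_image (linepath (f u) (f v)) \<subseteq> convex hull {f u, f w, f v}"
            by (simp add: seg)
        qed simp_all
      qed (rule IH)
    qed
  qed
  then show ?thesis using uv K by blast
qed

section \<open>Open stars in the geometric realization\<close>

text \<open>
  With the vertices at the standard basis vectors, the coordinates of a point are its barycentric
  coordinates, whatever simplex it is viewed in. Hence a simplex containing a point has all vertices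
  at which the coordinates are positive.
\<close>

lemma barycentric_coordinates:
  fixes F :: "'a::finite set"
  assumes "x \<in> convex hull ((\<lambda>v. axis v (1::real)) ` F)"
  shows "0 \<le> x $ v" "v \<notin> F \<Longrightarrow> x $ v = 0" "(\<Sum>v\<in>UNIV. x $ v) = 1"
proof -
  let ?C = "{x :: real ^ 'a. (\<forall>v. 0 \<le> x $ v) \<and> (\<forall>v. v \<notin> F \<longrightarrow> x $ v = 0) \<and> (\<Sum>v\<in>UNIV. x $ v) = 1}"
  have "convex ?C"
    by (auto simp: convex_def sum.distrib simp flip: sum_distrib_left)
  moreover have "(\<lambda>v. axis v (1::real)) ` F \<subseteq> ?C"
    by (auto simp: axis_def)
  ultimately have "convex hull ((\<lambda>v. axis v (1::real)) ` F) \<subseteq> ?C"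
    by (intro hull_minimal)
  then have "x \<in> ?C" using assms by (rule subsetD)
  then show "0 \<le> x $ v" "v \<notin> F \<Longrightarrow> x $ v = 0" "(\<Sum>v\<in>UNIV. x $ v) = 1" by auto
qed

lemma exists_positive_coordinate:
  assumes "x \<in> geometric_realization K"
  shows "\<exists>v. x $ v > 0"
proof (rule ccontr)
  assume "\<nexists>v. x $ v > 0"
  then have "(\<Sum>v\<in>UNIV. x $ v) \<le> 0" by (intro sum_nonpos) (simp add: not_less)
  moreover obtain F where "x \<in> convex hull ((\<lambda>v. axis v 1) ` F)"
    using assms by (auto simp: geometric_realization_def)
  ultimately show False using barycentric_coordinates(3)[of x F] by simp
qed

lemma simplex_in_realization:
  assumes "F \<in> K"
  shows "convex hull ((\<lambda>v. axis v 1) ` F) \<subseteq> geometric_realization K"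
  using assms unfolding geometric_realization_def by blast

lemma carrier_simplex:
  assumes "x \<in> geometric_realization K"
  obtains F where "F \<in> K" "x \<in> convex hull ((\<lambda>v. axis v 1) ` F)" "\<And>v. x $ v > 0 \<Longrightarrow> v \<in> F"
proof -
  obtain F where "F \<in> K" and x: "x \<in> convex hull ((\<lambda>v. axis v 1) ` F)"
    using assms by (auto simp: geometric_realization_def)
  moreover have "v \<in> F" if "x $ v > 0" for v
    using barycentric_coordinates(2)[OF x, of v] that by (cases "v \<in> F") auto
  ultimately show thesis by (rule that)
qed

definition open_star :: "'a::finite set set \<Rightarrow> 'a \<Rightarrow> (real ^ 'a) set" where
  "open_star K v = {x \<in> geometric_realization K. x $ v > 0}"

lemma segment_in_open_star:
  assumes "x \<in> open_star K v"
  shows "closed_segment (axis v 1) x \<subseteq> open_star K v"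
proof
  fix y assume y: "y \<in> closed_segment (axis v 1) x"
  have x: "x \<in> geometric_realization K" "x $ v > 0" using assms by (auto simp: open_star_def)
  obtain F where F: "F \<in> K" "x \<in> convex hull ((\<lambda>v. axis v 1) ` F)" "v \<in> F"
    using carrier_simplex[OF x(1)] x(2) by metis
  have "closed_segment (axis v 1) x \<subseteq> convex hull ((\<lambda>v. axis v 1) ` F)"
    using F by (intro closed_segment_subset convex_convex_hull) (auto intro: hull_inc)
  then have "y \<in> geometric_realization K" using y F by (auto simp: geometric_realization_def)
  moreover have "convex {z :: real ^ 'a. z $ v > 0}"
    using convex_halfspace_gt[of 0 "axis v 1 :: real ^ 'a"] by (simp add: inner_axis' axis_nth)
  then have "closed_segment (axis v 1) x \<subseteq> {z. z $ v > 0}"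
    using x(2) by (intro closed_segment_subset) (auto simp: axis_nth)
  ultimately show "y \<in> open_star K v" using y by (auto simp: open_star_def)
qed

lemma simply_connected_open_star:
  assumes "x \<in> open_star K v"
  shows "simply_connected (open_star K v)"
proof (rule starlike_imp_simply_connected)
  have "axis v 1 \<in> open_star K v" using segment_in_open_star[OF assms] by auto
  then show "starlike (open_star K v)"
    using segment_in_open_star unfolding starlike_def by blast
qed

lemma open_star_ball:
  assumes "x \<in> geometric_realization K"
  shows "\<exists>v. \<exists>e>0. geometric_realization K \<inter> ball x e \<subseteq> open_star K v"
proof -
  obtain v where "x $ v > 0" using exists_positive_coordinate[OF assms] by blast
  moreover have "open {y :: real ^ 'a. y $ v > 0}"
    by (intro open_Collect_less continuous_intros)
  ultimately obtain e where "e > 0" "ball x e \<subseteq> {y. y $ v > 0}"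
    unfolding open_contains_ball by blast
  then show ?thesis by (auto simp: open_star_def)
qed

text \<open>
  Consistency along the edges is all that has to be checked. The base path of \<open>x\<close> goes through an
  arbitrary vertex \<open>b x\<close> of its carrier simplex; any other vertex \<open>v\<close> of that simplex would do as
  well, since the edge from \<open>b x\<close> to \<open>v\<close> is consistent and the triangle \<open>b x, v, x\<close> lies in one simplex.
  A path in the open star of \<open>v\<close> is homotopic to the detour through \<open>v\<close>, and its two ends may both be
  assumed to be reached through \<open>v\<close>.
\<close>

lemma simply_connected_realization:
  fixes K :: "'a::finite set set"
  assumes base: "\<And>v. {v} \<in> K \<Longrightarrow> path (g v) \<and> path_image (g v) \<subseteq> geometric_realization K
                    \<and> pathstart (g v) = r \<and> pathfinish (g v) = axis v 1"
    and edge: "\<And>u v. u \<noteq> v \<Longrightarrow> {u, v} \<in> K \<Longrightarrow>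
        carries (geometric_realization K) (g u) (linepath (axis u 1) (axis v 1)) (g v)"
    and faces: "\<And>F u v. \<lbrakk>F \<in> K; u \<in> F; v \<in> F\<rbrakk> \<Longrightarrow> {u, v} \<in> K"
  shows "simply_connected (geometric_realization K)"
proof -
  let ?X = "geometric_realization K" and ?p = "\<lambda>v::'a. axis v (1::real)"
  define b where "b x = (SOME v. x $ v > 0)" for x :: "real ^ 'a"
  define h where "h x = g (b x) +++ linepath (?p (b x)) x" for x
  have b: "x $ b x > 0" if "x \<in> ?X" for x
    unfolding b_def using exists_positive_coordinate[OF that] by (rule someI_ex)
  have vertex: "{v} \<in> K" if "x \<in> ?X" "x $ v > 0" for x v
    using carrier_simplex[OF that(1)] faces[of _ v v] that(2) by (metis insert_absorb2)
  have outward: "carries ?X (g (b x)) (linepath (?p (b x)) x) (h x)" if "x \<in> ?X" for x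
  proof -
    have "closed_segment (?p (b x)) x \<subseteq> ?X"
      using segment_in_open_star[of x K "b x"] b that by (auto simp: open_star_def)
    then show ?thesis unfolding h_def
      using base[OF vertex[OF that b[OF that]]] by (intro carries_join_self) auto
  qed
  have inward: "carries ?X (h x) (linepath x (?p v)) (g v)" if x: "x \<in> ?X" and v: "x $ v > 0" for x v
  proof -
    obtain F where F: "F \<in> K" "x \<in> convex hull (?p ` F)" "v \<in> F" "b x \<in> F"
      using carrier_simplex[OF x] v b[OF x] by metis
    have D: "convex hull (?p ` F) \<subseteq> ?X" by (rule simplex_in_realization[OF F(1)])
    have pv: "?p v \<in> convex hull (?p ` F)" "?p (b x) \<in> convex hull (?p ` F)"
      using F by (auto intro: hull_inc)
    have "carries ?X (g (b x)) (linepath (?p (b x)) (?p v)) (g v)"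
    proof (cases "b x = v")
      case True
      then show ?thesis using base[OF vertex[OF x v]] by (auto intro: carries_const)
    next
      case False
      then show ?thesis using edge faces F by blast
    qed
    moreover have "carries ?X (h x) (linepath x (?p (b x))) (g (b x))"
      using carries_reverse[OF outward[OF x]] by simp
    ultimately have "carries ?X (h x) (linepath x (?p (b x)) +++ linepath (?p (b x)) (?p v)) (g v)"
      by (rule carries_trans[rotated])
    then show ?thesis
    proof (rule carries_within_simply_connected[OF _ _ _ _ _ D])
      show "simply_connected (convex hull (?p ` F))" by (simp add: convex_imp_simply_connected)
      show "path_image (linepath x (?p (b x)) +++ linepath (?p (b x)) (?p v)) \<subseteq> convex hull (?p ` F)"
        using pv F by (intro subset_path_image_join) (simp_all add: closed_segment_subset)
      show "path_image (linepath x (?p v)) \<subseteq> convex hull (?p ` F)"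
        using pv F by (simp add: closed_segment_subset)
    qed simp_all
  qed
  show ?thesis
  proof (rule simply_connected_if_carries[where h = h and r = r])
    fix x assume x: "x \<in> ?X"
    show "path (h x) \<and> path_image (h x) \<subseteq> ?X \<and> pathstart (h x) = r \<and> pathfinish (h x) = x"
      using carriesD[OF outward[OF x]] base[OF vertex[OF x b[OF x]]] by simp
  next
    fix x assume x: "x \<in> ?X"
    then obtain v e where e: "e > 0" "?X \<inter> ball x e \<subseteq> open_star K v" using open_star_ball by blast
    show "\<exists>e>0. \<forall>p. path p \<and> path_image p \<subseteq> ?X \<inter> ball x e \<longrightarrow> carries ?X (h (pathstart p)) p (h (pathfinish p))"
    proof (intro exI[of _ e] conjI allI impI)
      fix p assume p: "path p \<and> path_image p \<subseteq> ?X \<inter> ball x e"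
      let ?s = "pathstart p" and ?t = "pathfinish p"
      have pS: "path_image p \<subseteq> open_star K v" using p e by blast
      then have st: "?s \<in> open_star K v" "?t \<in> open_star K v" by (auto)
      have "carries ?X (h ?s) (linepath ?s (?p v)) (g v)" "carries ?X (h ?t) (linepath ?t (?p v)) (g v)"
        using st inward by (auto simp: open_star_def)
      then have "carries ?X (h ?s) (linepath ?s (?p v) +++ linepath (?p v) ?t) (h ?t)"
        using carries_reverse carries_trans by fastforce
      then show "carries ?X (h ?s) p (h ?t)"
      proof (rule carries_within_simply_connected)
        show "simply_connected (open_star K v)" using simply_connected_open_star st by blast
        show "open_star K v \<subseteq> ?X" by (auto simp: open_star_def)
        show "path_image (linepath ?s (?p v) +++ linepath (?p v) ?t) \<subseteq> open_star K v"
          using segment_in_open_star[OF st(1)] segment_in_open_star[OF st(2)]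
          by (intro subset_path_image_join) (auto simp: closed_segment_commute)
      qed (use p pS in auto)
    qed (rule e)
  qed
qed

section \<open>Activated spanning trees\<close>

lemma triangle_complex_pair:
  assumes "finite_simple_graph G" "F \<in> triangle_complex G" "u \<in> F" "v \<in> F"
  shows "{u, v} \<in> triangle_complex G"
proof -
  have sub: "e \<subseteq> verts G" "card e = 2" if "e \<in> edges G" for e
    using assms(1) that by (auto simp: finite_simple_graph_def)
  have V: "{w} \<in> triangle_complex G" if "w \<in> verts G" for w using that by (auto simp: triangle_complex_def)
  consider "F \<in> (\<lambda>v. {v}) ` verts G" | "F \<in> edges G" | "F \<in> triangles G"
    using assms(2) by (auto simp: triangle_complex_def)
  then show ?thesis
  proof cases
    case 1
    then show ?thesis using assms V by auto
  next
    case 2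
    then obtain a b where "F = {a, b}" using sub by (meson card_2_iff)
    then show ?thesis using 2 assms V sub(1)[OF 2]
      by (auto simp: triangle_complex_def insert_commute)
  next
    case 3
    then obtain a b c where t: "F = {a, b, c}" "{a, b} \<in> edges G" "{b, c} \<in> edges G" "{a, c} \<in> edges G"
      by (auto simp: triangles_def)
    then have "{a, b, c} \<subseteq> verts G" using sub(1) by blast
    then show ?thesis using t assms(3,4) V
      by (auto simp: triangle_complex_def insert_commute)
  qed
qed

theorem lemma4p1:
  fixes G :: "'a::finite sgraph"
  assumes "finite_simple_graph G"
    and "\<exists>T. spanning_tree T G \<and> activates T G"
  shows "simply_connected (geometric_realization (triangle_complex G))"
proof -
  let ?K = "triangle_complex G" and ?p = "\<lambda>v::'a. axis v (1::real)"
  let ?X = "geometric_realization ?K"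
  obtain T where T: "tree T" "verts T = verts G" "edges T \<subseteq> edges G" and act: "activates T G"
    using assms(2) by (auto simp: spanning_tree_def spanning_subgraph_def)
  have simple: "\<forall>e\<in>edges G. e \<subseteq> verts G \<and> card e = 2"
    using assms(1) by (auto simp: finite_simple_graph_def)
  obtain r where r: "r \<in> verts T" using T(1) by (auto simp: tree_def connected_graph_def)
  have card_triangle: "card F = 3" if F: "F \<in> triangles G" for F
  proof -
    obtain a b c where abc: "F = {a, b, c}" "{a, b} \<in> edges G" "{b, c} \<in> edges G" "{a, c} \<in> edges G"
      using F by (auto simp: triangles_def)
    then have "card {a, b} = 2" "card {b, c} = 2" "card {a, c} = 2" using simple by blast+
    then have "a \<noteq> b" "b \<noteq> c" "a \<noteq> c" by auto
    then show ?thesis using abc by simp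
  qed
  have face: "convex hull (?p ` F) \<subseteq> ?X" if "F \<in> ?K" for F
    by (rule simplex_in_realization[OF that])
  have pr: "?p r \<in> ?X" using face[of "{r}"] r T by (auto simp: triangle_complex_def)
  have seg: "closed_segment (?p u) (?p v) \<subseteq> ?X" if "{u, v} \<in> edges T" for u v
    using face[of "{u, v}"] that T by (auto simp: triangle_complex_def segment_convex_hull)
  have simpleT: "\<forall>e\<in>edges T. e \<subseteq> verts T \<and> card e = 2" using simple T by auto
  obtain g where
    g: "\<And>v. v \<in> verts T \<Longrightarrow> path (g v) \<and> path_image (g v) \<subseteq> ?X \<and> pathstart (g v) = ?p r \<and> pathfinish (g v) = ?p v"
    and c: "\<And>u v. {u, v} \<in> edges T \<Longrightarrow> carries ?X (g u) (linepath (?p u) (?p v)) (g v)"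
    using tree_base_paths[where f = ?p and S = ?X, OF T(1) finite simpleT r pr seg] by blast
  show ?thesis
  proof (rule simply_connected_realization)
    fix v assume "{v} \<in> ?K"
    moreover have "{v} \<notin> edges G" "{v} \<notin> triangles G" using simple card_triangle by fastforce+
    ultimately have "v \<in> verts T" using T by (auto simp: triangle_complex_def)
    then show "path (g v) \<and> path_image (g v) \<subseteq> ?X \<and> pathstart (g v) = ?p r \<and> pathfinish (g v) = ?p v"
      by (rule g)
  next
    fix u v assume uv: "u \<noteq> v" "{u, v} \<in> ?K"
    then have "{u, v} \<notin> triangles G" using card_triangle by fastforce
    then have "{u, v} \<in> edges G" using uv by (auto simp: triangle_complex_def)
    then show "carries ?X (g u) (linepath (?p u) (?p v)) (g v)"
    proof (rule activation_carries[OF act, rotated -1])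
      fix u v w assume "{u, v, w} \<in> triangles G"
      then show "convex hull {?p u, ?p v, ?p w} \<subseteq> ?X"
        using face[of "{u, v, w}"] by (auto simp: triangle_complex_def)
    qed (use simple c in auto)
  qed (rule triangle_complex_pair[OF assms(1)])
qed

end
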